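(* Let $n\in\mathbb N$, $\nu_0,\dots,\nu_n\in\mathbb R$, $0=\rho_0<\rho_1<\dots<\rho_n$, and $\beta_i\in[-\rho_i,\rho_i]$ for $i=0,\dots,n$ (in particular $\beta_0=0$). Assume that (i) $|\beta_i-\beta_{i-1}|\le\rho_i-\rho_{i-1}$ for $i=1,\dots,n$; (ii) $A_i:=\sum_{j=0}^i\nu_j>0$ for $i=0,\dots,n$. Define $B_i:=1/A_i$ for $i=0,\dots,n$, and $$\sigma_0=\gamma_0=0,\qquad \sigma_i-\sigma_{i-1}=A_{i-1}(\rho_i-\rho_{i-1}),\qquad \gamma_i-\gamma_{i-1}=A_{i-1}(\beta_i-\beta_{i-1}),$$ $$\zeta_0:=B_0,\qquad \zeta_i:=B_i-B_{i-1}$$ for $i=1,\dots,n$. For an arbitrary real sequence $x=(x_0,x_1,\dots)$ put $$v=\sum_{i=0}^n\nu_i\,\mathfrak p_{\rho_i}[\beta_i,x].$$ Then $$x=\sum_{i=0}^n\zeta_i\,\mathfrak p_{\sigma_i}[\gamma_i,v].$$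
   Context: For $\rho>0$, the saturation function is $\Phi_\rho(v)=\rho$ if $v\ge\rho$, $\Phi_\rho(v)=v$ if $-\rho<v<\rho$, $\Phi_\rho(v)=-\rho$ if $v\le-\rho$. For $\beta\in[-\rho,\rho]$ and a real sequence $x=(x_0,x_1,\dots)$, the (discrete time) play operator $\mathfrak p_\rho[\beta,x]$ is the real sequence $(p_0,p_1,\dots)$ with $p_0=x_0-\beta$ and $p_t=x_t+\Phi_\rho(p_{t-1}-x_t)$ for $t\in\mathbb N=\{1,2,\dots\}$. By convention $\mathfrak p_0[0,x]=x$. Sums and scalar multiples of sequences are taken termwise. *)

theory Defs
  imports Complex_Main
begin

definition saturation :: "real \<Rightarrow> real \<Rightarrow> real" where
  "saturation \<rho> v = (if v \<ge> \<rho> then \<rho> else if v > - \<rho> then v else - \<rho>)"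

text \<open>
  Play operator with threshold \<open>\<rho> \<ge> 0\<close> and initial state \<open>\<beta>\<close> in \<open>{-\<rho>..\<rho>}\<close>. The recursion is
  applied verbatim also outside this range of parameters. The case \<open>\<rho> = 0\<close> needs no special
  clause: \<open>play_zero\<close> below shows that it agrees with the convention that the play operator with
  \<open>\<rho> = \<beta> = 0\<close> is the identity.
\<close>

primrec play :: "real \<Rightarrow> real \<Rightarrow> (nat \<Rightarrow> real) \<Rightarrow> nat \<Rightarrow> real" where
  "play \<rho> \<beta> x 0 = x 0 - \<beta>"
| "play \<rho> \<beta> x (Suc t) = x (Suc t) + saturation \<rho> (play \<rho> \<beta> x t - x (Suc t))"

lemma play_zero: "play 0 0 x = x"
proof
  fix t show "play 0 0 x t = x t"
    by (cases t) (simp_all add: saturation_def)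
qed

text \<open>Recursively defined parameters are admissible for the play operator.\<close>

lemma admissible_params:
  fixes n :: nat and \<rho> \<beta> A \<sigma> \<gamma> :: "nat \<Rightarrow> real"
  assumes "\<And>i. i \<in> {1..n} \<Longrightarrow> \<rho> (i - 1) < \<rho> i"
    and "\<And>i. i \<in> {1..n} \<Longrightarrow> \<bar>\<beta> i - \<beta> (i - 1)\<bar> \<le> \<rho> i - \<rho> (i - 1)"
    and "\<And>i. i \<le> n \<Longrightarrow> A i > 0"
    and "\<sigma> 0 = 0" and "\<gamma> 0 = 0"
    and "\<And>i. i \<in> {1..n} \<Longrightarrow> \<sigma> i - \<sigma> (i - 1) = A (i - 1) * (\<rho> i - \<rho> (i - 1))"
    and "\<And>i. i \<in> {1..n} \<Longrightarrow> \<gamma> i - \<gamma> (i - 1) = A (i - 1) * (\<beta> i - \<beta> (i - 1))"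
    and "i \<le> n"
  shows "\<sigma> i \<ge> 0 \<and> (i > 0 \<longrightarrow> \<sigma> i > 0) \<and> \<gamma> i \<in> {- \<sigma> i..\<sigma> i}"
  using \<open>i \<le> n\<close>
proof (induction i)
  case 0
  show ?case using assms(4,5) by simp
next
  case (Suc i)
  have mem: "Suc i \<in> {1..n}" using Suc.prems by simp
  have A: "A i > 0" using assms(3) Suc.prems by simp
  have s: "\<sigma> (Suc i) - \<sigma> i = A i * (\<rho> (Suc i) - \<rho> i)" using assms(6)[OF mem] by simp
  have g: "\<gamma> (Suc i) - \<gamma> i = A i * (\<beta> (Suc i) - \<beta> i)" using assms(7)[OF mem] by simp
  have pos: "A i * (\<rho> (Suc i) - \<rho> i) > 0" using A assms(1)[OF mem] by simp
  have "\<bar>A i * (\<beta> (Suc i) - \<beta> i)\<bar> \<le> A i * (\<rho> (Suc i) - \<rho> i)"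
    using A assms(2)[OF mem] by (simp add: abs_mult)
  then show ?case using s g pos Suc.IH Suc.prems by (simp add: abs_le_iff)
qed

end

theory Submission
  imports Defs
begin

text \<open>
  Write \<open>p\<^sub>i\<close> for the \<open>i\<close>-th play of \<open>x\<close> and put
  \<open>u\<^sub>i = A\<^sub>i p\<^sub>i + \<nu>\<^sub>i\<^sub>+\<^sub>1 p\<^sub>i\<^sub>+\<^sub>1 + \<dots> + \<nu>\<^sub>n p\<^sub>n\<close>, so that \<open>u\<^sub>0 = v\<close> and
  \<open>u\<^sub>i\<^sub>+\<^sub>1 - u\<^sub>i = A\<^sub>i (p\<^sub>i\<^sub>+\<^sub>1 - p\<^sub>i)\<close>. Summation by parts gives
  \<open>\<zeta>\<^sub>0 u\<^sub>0 + \<dots> + \<zeta>\<^sub>n u\<^sub>n = p\<^sub>0 = x\<close>, hence it suffices that \<open>u\<^sub>i\<close> is the play of \<open>v\<close> with parameters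
  \<open>\<sigma>\<^sub>i, \<gamma>\<^sub>i\<close>. The bound \<open>\<bar>p\<^sub>i\<^sub>+\<^sub>1 - p\<^sub>i\<bar> \<le> \<rho>\<^sub>i\<^sub>+\<^sub>1 - \<rho>\<^sub>i\<close> is preserved in time; it makes
  \<open>p\<^sub>i + \<rho>\<^sub>i\<close> nondecreasing and \<open>p\<^sub>i - \<rho>\<^sub>i\<close> nonincreasing in \<open>i\<close>. Thus in every time step the plays
  that move form an initial segment of the indices and all move in the same direction, by an
  amount that decreases in \<open>i\<close>. If the \<open>i\<close>-th play rests, so do all later ones and \<open>u\<^sub>i\<close> rests; if it
  moves, then \<open>u\<^sub>i\<close> moves in the same direction and ends on the boundary \<open>v \<plusminus> \<sigma>\<^sub>i\<close>.
\<close>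

lemma add_saturation_eq_clamp:
  assumes "\<rho> \<ge> 0"
  shows "c + saturation \<rho> (w - c) = max (c - \<rho>) (min (c + \<rho>) w)"
  using assms by (auto simp: saturation_def max_def min_def)

lemma abs_clamp_diff_le:
  fixes r s a b c :: real
  assumes "0 \<le> r" "r \<le> s" "\<bar>b - a\<bar> \<le> s - r"
  shows "\<bar>max (c - s) (min (c + s) b) - max (c - r) (min (c + r) a)\<bar> \<le> s - r"
  using assms by (auto simp: max_def min_def abs_le_iff)

lemma abs_play_diff_le:
  assumes "0 \<le> r" "r \<le> s" "\<bar>\<beta>' - \<beta>\<bar> \<le> s - r"
  shows "\<bar>play s \<beta>' x t - play r \<beta> x t\<bar> \<le> s - r"
proof (induction t)
  case 0
  show ?case using assms by (simp add: abs_minus_commute)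
next
  case (Suc t)
  then show ?case
    using assms by (simp add: add_saturation_eq_clamp abs_clamp_diff_le)
qed

text \<open>The combination \<open>u\<^sub>i\<close> of the introduction, after summation by parts.\<close>

definition tail_comb :: "(nat \<Rightarrow> real) \<Rightarrow> nat \<Rightarrow> (nat \<Rightarrow> real) \<Rightarrow> nat \<Rightarrow> real" where
  "tail_comb A n p i = A n * p n - (\<Sum>j=i..<n. A j * (p (Suc j) - p j))"

lemma tail_comb_last: "tail_comb A n p n = A n * p n"
  by (simp add: tail_comb_def)

lemma tail_comb_Suc:
  assumes "i < n"
  shows "tail_comb A n p (Suc i) = tail_comb A n p i + A i * (p (Suc i) - p i)"
  using assms by (simp add: tail_comb_def sum.atLeast_Suc_lessThan)

lemma tail_comb_0:
  "(\<Sum>i=0..n. \<nu> i * p i) = tail_comb (\<lambda>i. \<Sum>j=0..i. \<nu> j) n p 0"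
  by (induction n) (simp_all add: tail_comb_def algebra_simps)

lemma tail_comb_cong:
  assumes "\<And>j. j \<le> n \<Longrightarrow> A j = A' j" "\<And>j. i \<le> j \<Longrightarrow> j \<le> n \<Longrightarrow> p j = p' j" "i \<le> n"
  shows "tail_comb A n p i = tail_comb A' n p' i"
  using assms by (simp add: tail_comb_def)

lemma tail_comb_diff:
  "tail_comb A n p i - tail_comb A n q i = tail_comb A n (\<lambda>j. p j - q j) i"
  by (simp add: tail_comb_def sum_subtractf sum.distrib algebra_simps)

lemma tail_comb_uminus: "tail_comb A n (\<lambda>j. - p j) i = - tail_comb A n p i"
  by (simp add: tail_comb_def sum_negf [symmetric] algebra_simps)

lemma tail_comb_nonneg:
  assumes "\<And>j. j \<le> n \<Longrightarrow> A j \<ge> 0" "d n \<ge> 0"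
    and "\<And>j. i \<le> j \<Longrightarrow> j < n \<Longrightarrow> d (Suc j) \<le> d j"
  shows "tail_comb A n d i \<ge> 0"
proof -
  have "(\<Sum>j=i..<n. A j * (d (Suc j) - d j)) \<le> 0"
    using assms by (intro sum_nonpos) (simp add: mult_nonneg_nonpos)
  moreover have "A n * d n \<ge> 0" using assms by simp
  ultimately show ?thesis by (simp add: tail_comb_def)
qed

lemma tail_comb_inverse:
  assumes "\<And>i. i \<le> n \<Longrightarrow> A i \<noteq> 0" "\<zeta> 0 = 1 / A 0"
    and "\<And>i. i < n \<Longrightarrow> \<zeta> (Suc i) = 1 / A (Suc i) - 1 / A i"
  shows "(\<Sum>i=0..n. \<zeta> i * tail_comb A n p i) = p 0"
proof -
  \<comment> \<open>Generalised to partial sums so that induction applies: dividing the increment of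
    \<open>tail_comb A n p\<close> at \<open>m\<close> by \<open>A m\<close> leaves
    \<open>p (Suc m) - p m\<close>, which telescopes. At \<open>m = n\<close> the quotient is
    \<open>p n\<close>.\<close>
  have "(\<Sum>i=0..m. \<zeta> i * tail_comb A n p i) = tail_comb A n p m / A m - (p m - p 0)" if "m \<le> n" for m
    using that
  proof (induction m)
    case 0
    show ?case using assms by simp
  next
    case (Suc m)
    have "A m \<noteq> 0" using assms(1) Suc.prems by simp
    then have "\<zeta> (Suc m) * tail_comb A n p (Suc m) =
        tail_comb A n p (Suc m) / A (Suc m) - tail_comb A n p m / A m - (p (Suc m) - p m)"
      using assms(3)[of m] Suc.prems by (simp add: tail_comb_Suc left_diff_distrib add_divide_distrib)
    then show ?case
      using Suc by simp
  qed
  from this[of n] show ?thesis using assms(1)[of n] by (simp add: tail_comb_last)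
qed

text \<open>The sequences \<open>a\<close>, \<open>b\<close> are the values of the plays before and after one time step with input \<open>c\<close>.\<close>

lemma tail_comb_clamp_up:
  fixes \<rho> a b A \<sigma> :: "nat \<Rightarrow> real"
  assumes A: "\<And>j. j \<le> n \<Longrightarrow> A j \<ge> 0"
    and \<rho>: "\<And>j. j \<le> n \<Longrightarrow> \<rho> j \<ge> 0"
    and a: "\<And>j. j < n \<Longrightarrow> \<bar>a (Suc j) - a j\<bar> \<le> \<rho> (Suc j) - \<rho> j"
    and b: "\<And>j. j \<le> n \<Longrightarrow> b j = max (c - \<rho> j) (min (c + \<rho> j) (a j))"
    and \<sigma>: "\<sigma> 0 = 0" "\<And>j. j < n \<Longrightarrow> \<sigma> (Suc j) - \<sigma> j = A j * (\<rho> (Suc j) - \<rho> j)"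
    and i: "i \<le> n" "a i + \<rho> i \<le> c"
  shows "tail_comb A n b i = tail_comb A n b 0 - \<sigma> i"
    and "tail_comb A n a i \<le> tail_comb A n b i"
proof -
  have below: "a j + \<rho> j \<le> c" if "j \<le> i" for j
    using that
  proof (induction rule: inc_induct)
    case base
    show ?case by (fact i)
  next
    case (step k)
    then show ?case using a[of k] i by (simp add: abs_le_iff)
  qed
  have b_low: "b j = c - \<rho> j" if "j \<le> i" for j
    using below[OF that] b[of j] \<rho>[of j] that i by simp
  have "tail_comb A n b j = tail_comb A n b 0 - \<sigma> j" if "j \<le> i" for j
    using that
  proof (induction j)
    case 0
    show ?case using \<sigma> by simp
  next
    case (Suc j)
    then have "b (Suc j) - b j = - (\<rho> (Suc j) - \<rho> j)"
      using b_low[of j] b_low[of "Suc j"] by simp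
    moreover have "\<sigma> (Suc j) - \<sigma> j = A j * (\<rho> (Suc j) - \<rho> j)"
      using \<sigma>(2)[of j] Suc.prems i by simp
    ultimately have "A j * (b (Suc j) - b j) = - (\<sigma> (Suc j) - \<sigma> j)"
      by (simp only: mult_minus_right)
    moreover have "tail_comb A n b (Suc j) = tail_comb A n b j + A j * (b (Suc j) - b j)"
      using Suc.prems i by (intro tail_comb_Suc) simp
    ultimately show ?case
      using Suc by linarith
  qed
  from this[OF order_refl] show "tail_comb A n b i = tail_comb A n b 0 - \<sigma> i" .
  \<comment> \<open>Later plays may rest or rise but never fall, since \<open>a j - \<rho> j\<close>
    is nonincreasing.\<close>
  have above: "a j \<le> c + \<rho> j" if "i \<le> j" "j \<le> n" for j
    using that
  proof (induction rule: dec_induct)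
    case base
    show ?case using i \<rho>[of i] by simp
  next
    case (step k)
    then show ?case using a[of k] by (simp add: abs_le_iff)
  qed
  have b_up: "b j - a j = max (c - \<rho> j - a j) 0" if "i \<le> j" "j \<le> n" for j
    using above[OF that] b[OF that(2)] by (auto simp: max_def min_def)
  have "tail_comb A n (\<lambda>j. b j - a j) i \<ge> 0"
  proof (rule tail_comb_nonneg)
    show "b n - a n \<ge> 0" using b_up[of n] i by simp
    \<comment> \<open>The upward displacement shrinks with \<open>j\<close> because
      \<open>a j + \<rho> j\<close> is nondecreasing.\<close>
    show "b (Suc j) - a (Suc j) \<le> b j - a j" if "i \<le> j" "j < n" for j
      using b_up[of j] b_up[of "Suc j"] that a[of j] by (auto simp: abs_le_iff)
  qed (fact A)
  then show "tail_comb A n a i \<le> tail_comb A n b i"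
    by (simp flip: tail_comb_diff)
qed

lemma abs_tail_comb_diff_le:
  fixes \<rho> b A \<sigma> :: "nat \<Rightarrow> real"
  assumes A: "\<And>j. j \<le> n \<Longrightarrow> A j \<ge> 0"
    and b: "\<And>j. j < n \<Longrightarrow> \<bar>b (Suc j) - b j\<bar> \<le> \<rho> (Suc j) - \<rho> j"
    and \<sigma>: "\<sigma> 0 = 0" "\<And>j. j < n \<Longrightarrow> \<sigma> (Suc j) - \<sigma> j = A j * (\<rho> (Suc j) - \<rho> j)"
    and "i \<le> n"
  shows "\<bar>tail_comb A n b i - tail_comb A n b 0\<bar> \<le> \<sigma> i"
  using \<open>i \<le> n\<close>
proof (induction i)
  case 0
  show ?case using \<sigma> by simp
next
  case (Suc i)
  have "\<bar>A i * (b (Suc i) - b i)\<bar> \<le> \<sigma> (Suc i) - \<sigma> i"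
    using A[of i] b[of i] \<sigma>(2)[of i] Suc.prems by (simp add: abs_mult mult_left_mono)
  then show ?case
    using Suc by (simp add: tail_comb_Suc abs_le_iff)
qed

text \<open>One time step of the claim: \<open>tail_comb A n b 0\<close> is the new value of
  \<open>v\<close>, so the right-hand side is the recursion of the play with threshold
  \<open>\<sigma> i\<close>.\<close>

lemma tail_comb_clamp:
  fixes \<rho> a b A \<sigma> :: "nat \<Rightarrow> real"
  assumes A: "\<And>j. j \<le> n \<Longrightarrow> A j \<ge> 0"
    and \<rho>: "\<And>j. j \<le> n \<Longrightarrow> \<rho> j \<ge> 0"
    and a: "\<And>j. j < n \<Longrightarrow> \<bar>a (Suc j) - a j\<bar> \<le> \<rho> (Suc j) - \<rho> j"
    and b: "\<And>j. j \<le> n \<Longrightarrow> b j = max (c - \<rho> j) (min (c + \<rho> j) (a j))"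
    and \<sigma>: "\<sigma> 0 = 0" "\<And>j. j < n \<Longrightarrow> \<sigma> (Suc j) - \<sigma> j = A j * (\<rho> (Suc j) - \<rho> j)"
    and i: "i \<le> n"
  shows "tail_comb A n b i =
    max (tail_comb A n b 0 - \<sigma> i) (min (tail_comb A n b 0 + \<sigma> i) (tail_comb A n a i))"
proof -
  have b_diff: "\<bar>b (Suc j) - b j\<bar> \<le> \<rho> (Suc j) - \<rho> j" if "j < n" for j
  proof -
    have "\<rho> j \<le> \<rho> (Suc j)" using a[OF that] by linarith
    then show ?thesis
      using abs_clamp_diff_le[of "\<rho> j" "\<rho> (Suc j)" "a (Suc j)" "a j" c] that
        \<rho>[of j] a[of j] b[of j] b[of "Suc j"] by simp
  qed
  have bound: "\<bar>tail_comb A n b i - tail_comb A n b 0\<bar> \<le> \<sigma> i"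
    using A b_diff \<sigma> i by (rule abs_tail_comb_diff_le)
  consider "a i + \<rho> i \<le> c" | "c \<le> a i - \<rho> i" | "c < a i + \<rho> i" "a i - \<rho> i < c"
    by linarith
  then show ?thesis
  proof cases
    case 1
    show ?thesis
      using tail_comb_clamp_up[OF A \<rho> a b \<sigma> i 1] bound by (auto simp: max_def min_def)
  next
    case 2
    \<comment> \<open>Downward motion is reduced to upward motion by changing the signs of
      \<open>a\<close>, \<open>b\<close> and \<open>c\<close>.\<close>
    have "\<bar>- a (Suc j) - - a j\<bar> \<le> \<rho> (Suc j) - \<rho> j" if "j < n" for j
      using a[OF that] by linarith
    moreover have "- b j = max (- c - \<rho> j) (min (- c + \<rho> j) (- a j))" if "j \<le> n" for j
      using b[OF that] \<rho>[OF that] by (auto simp: max_def min_def)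
    moreover have "- a i + \<rho> i \<le> - c" using 2 by simp
    ultimately have "tail_comb A n (\<lambda>j. - b j) i = tail_comb A n (\<lambda>j. - b j) 0 - \<sigma> i"
      and "tail_comb A n (\<lambda>j. - a j) i \<le> tail_comb A n (\<lambda>j. - b j) i"
      using A \<rho> \<sigma> i
        tail_comb_clamp_up[of n A \<rho> "\<lambda>j. - a j" "\<lambda>j. - b j" "- c" \<sigma> i] by auto
    then show ?thesis
      using bound by (auto simp: tail_comb_uminus max_def min_def)
  next
    case 3
    \<comment> \<open>All plays from \<open>i\<close> on rest, and \<open>tail_comb\<close> at
      \<open>i\<close> sees only these indices.\<close>
    have rest: "c < a j + \<rho> j \<and> a j - \<rho> j < c" if "i \<le> j" "j \<le> n" for j
      using that
    proof (induction rule: dec_induct)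
      case base
      show ?case using 3 by simp
    next
      case (step k)
      then show ?case using a[of k] by (simp add: abs_le_iff)
    qed
    have "b j = a j" if "i \<le> j" "j \<le> n" for j
      using rest[OF that] b[OF that(2)] by (auto simp: max_def min_def)
    then have "tail_comb A n b i = tail_comb A n a i"
      using i by (intro tail_comb_cong) auto
    then show ?thesis
      using bound by (auto simp: max_def min_def)
  qed
qed

theorem theorem4p6:
  fixes n :: nat and \<nu> \<rho> \<beta> A B \<sigma> \<gamma> \<zeta> :: "nat \<Rightarrow> real" and x v :: "nat \<Rightarrow> real"
  assumes "n \<ge> 1"
    and "\<rho> 0 = 0"
    and "\<And>i. i \<in> {1..n} \<Longrightarrow> \<rho> (i - 1) < \<rho> i"
    and "\<And>i. i \<in> {0..n} \<Longrightarrow> \<beta> i \<in> {- \<rho> i..\<rho> i}"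
    and "\<And>i. i \<in> {1..n} \<Longrightarrow> \<bar>\<beta> i - \<beta> (i - 1)\<bar> \<le> \<rho> i - \<rho> (i - 1)"
    and "\<And>i. i \<in> {0..n} \<Longrightarrow> A i = (\<Sum>j=0..i. \<nu> j)"
    and "\<And>i. i \<in> {0..n} \<Longrightarrow> A i > 0"
    and "\<And>i. i \<in> {0..n} \<Longrightarrow> B i = 1 / A i"
    and "\<sigma> 0 = 0" and "\<gamma> 0 = 0"
    and "\<And>i. i \<in> {1..n} \<Longrightarrow> \<sigma> i - \<sigma> (i - 1) = A (i - 1) * (\<rho> i - \<rho> (i - 1))"
    and "\<And>i. i \<in> {1..n} \<Longrightarrow> \<gamma> i - \<gamma> (i - 1) = A (i - 1) * (\<beta> i - \<beta> (i - 1))"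
    and "\<zeta> 0 = B 0"
    and "\<And>i. i \<in> {1..n} \<Longrightarrow> \<zeta> i = B i - B (i - 1)"
    and "v = (\<lambda>t. \<Sum>i=0..n. \<nu> i * play (\<rho> i) (\<beta> i) x t)"
  shows "x = (\<lambda>t. \<Sum>i=0..n. \<zeta> i * play (\<sigma> i) (\<gamma> i) v t)"
proof -
  define p where "p t i = play (\<rho> i) (\<beta> i) x t" for t i
  have \<rho>_diff: "\<rho> i < \<rho> (Suc i)" if "i < n" for i
    using assms(3)[of "Suc i"] that by simp
  have \<beta>_diff: "\<bar>\<beta> (Suc i) - \<beta> i\<bar> \<le> \<rho> (Suc i) - \<rho> i" if "i < n" for i
    using assms(5)[of "Suc i"] that by simp
  have \<sigma>: "\<sigma> (Suc i) - \<sigma> i = A i * (\<rho> (Suc i) - \<rho> i)" if "i < n" for i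
    using assms(11)[of "Suc i"] that by simp
  have \<gamma>: "\<gamma> (Suc i) - \<gamma> i = A i * (\<beta> (Suc i) - \<beta> i)" if "i < n" for i
    using assms(12)[of "Suc i"] that by simp
  have A: "A i > 0" if "i \<le> n" for i
    using assms(7) that by simp
  have \<rho>: "\<rho> i \<ge> 0" if "i \<le> n" for i
    using assms(4)[of i] that by simp
  have \<sigma>_nonneg: "\<sigma> i \<ge> 0" if "i \<le> n" for i
    using admissible_params[of n \<rho> \<beta> A \<sigma> \<gamma> i] assms that by simp
  have v: "v t = tail_comb A n (p t) 0" for t
    unfolding assms(15) p_def tail_comb_0 using assms(6) by (intro tail_comb_cong) auto
  have "play (\<sigma> i) (\<gamma> i) v t = tail_comb A n (p t) i" if "i \<le> n" for i t
  proof (induction t)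
    case 0
    \<comment> \<open>Since \<open>p 0 j = x 0 - \<beta> j\<close>, each increment of
      \<open>tail_comb\<close> is minus the increment of \<open>\<gamma>\<close>.\<close>
    have "tail_comb A n (p 0) i = tail_comb A n (p 0) 0 - \<gamma> i"
      using that
    proof (induction i)
      case 0
      show ?case using assms(10) by simp
    next
      case (Suc i)
      then show ?case
        using \<gamma>[of i] by (simp add: tail_comb_Suc p_def algebra_simps)
    qed
    then show ?case by (simp add: v)
  next
    case (Suc t)
    have a: "\<bar>p t (Suc j) - p t j\<bar> \<le> \<rho> (Suc j) - \<rho> j" if "j < n" for j
      unfolding p_def using that \<rho>[of j] \<rho>_diff[of j] \<beta>_diff[of j]
      by (intro abs_play_diff_le) auto
    have b: "p (Suc t) j = max (x (Suc t) - \<rho> j) (min (x (Suc t) + \<rho> j) (p t j))"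
      if "j \<le> n" for j
      using \<rho>[OF that] by (simp add: p_def add_saturation_eq_clamp)
    show ?case
      using tail_comb_clamp[OF less_imp_le[OF A] \<rho> a b assms(9) \<sigma> that] Suc \<sigma>_nonneg[OF that]
      by (simp add: add_saturation_eq_clamp v)
  qed
  moreover have "(\<Sum>i=0..n. \<zeta> i * tail_comb A n (p t) i) = p t 0" for t
  proof (rule tail_comb_inverse)
    show "A i \<noteq> 0" if "i \<le> n" for i using A[OF that] by simp
    show "\<zeta> 0 = 1 / A 0" using assms(8,13) by simp
    show "\<zeta> (Suc i) = 1 / A (Suc i) - 1 / A i" if "i < n" for i
      using assms(14)[of "Suc i"] assms(8)[of i] assms(8)[of "Suc i"] that by simp
  qed
  moreover have "p t 0 = x t" for t
    \<comment> \<open>The interval for \<open>\<beta> 0\<close> is degenerate, so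
      \<open>\<beta> 0 = 0\<close> and this play is the identity.\<close>
    using assms(2) assms(4)[of 0] by (simp add: p_def play_zero)
  ultimately show ?thesis by simp
qed

end
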